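(* Let $A \subseteq \mathbb{R}$ be a finite set containing at least two elements, and let $d \geq 1$ be an integer. Let $$k(A,d) = d + \max_{1 \leq s \leq d} \left( \left\lfloor \frac{d}{s} \right\rfloor (W(A,s) - s) \right),$$ and let $m(A,d)$ be a constant (such a constant exists) with the property that for all integers $k \geq k(A,d)$ and $n \geq 2k$, every $A$-valued degree $d$ function on the slice $\binom{[n]}{k}$ is an $m(A,d)$-junta. Then the following holds. If $k \geq k(A,d)$ is an integer then every $A$-valued degree $d$ function on the infinite slice $\binom{[\infty]}{k}$ is an $m(A,d)$-junta. Conversely, if $1 \leq k < k(A,d)$ then there exists an $A$-valued degree $d$ function on $\binom{[\infty]}{k}$ which is not an $m$-junta for any finite $m$.
   Context: For an integer $s \geq 1$, $W(A,s)$ is the minimal value $W$ such that every univariate real polynomial $P$ of degree at most $s$ satisfying $P(0), P(1), \ldots, P(W) \in A$ is constant. Finite slice: for integers $0 \leq k \leq n$, $\binom{[n]}{k} = \{x \in \{0,1\}^n : \sum_{i=1}^n x_i = k\}$. A function $f$ on $\binom{[n]}{k}$ has degree $d$ (meaning at most $d$) if it agrees on $\binom{[n]}{k}$ with a real polynomial of degree at most $d$ in $x_1,\ldots,x_n$. Infinite slice: for an integer $k \geq 0$, $\binom{[\infty]}{k} = \{x \in \{0,1\}^{\mathbb{N}} : \sum_{i=1}^\infty x_i = k\}$, where $\mathbb{N} = \{1,2,\ldots\}$. A function $f\colon \binom{[\infty]}{k} \to \mathbb{R}$ has degree $d$ if it can be expressed as a (possibly infinite) sum $f(x) = \sum_{S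 \subseteq \mathbb{N},\, |S| \leq d} c(S) x_S$ with real coefficients $c(S)$, where $x_S = \prod_{i \in S} x_i$ (with $x_\emptyset = 1$); only finitely many monomials are non-zero on any given input, so the sum is well-defined. In both settings: $f$ is $A$-valued if all its values lie in $A$. For a set $J$ of coordinates, $f$ is a $J$-junta if there is a function $g\colon \{0,1\}^J \to \mathbb{R}$ such that $f(x) = g(x|_J)$ for all $x$ in the domain, where $x|_J$ is the restriction of $x$ to the coordinates in $J$. $f$ is an $m$-junta if it is a $J$-junta for some set $J$ of size at most $m$. *)

theory Defs
  imports "HOL-Analysis.Analysis" "HOL-Computational_Algebra.Polynomial" "HOL-Library.Poly_Mapping"
begin

text \<open>For finite \<open>A\<close> and \<open>s \<ge> 1\<close> the least value exists: a nonconstant polynomial of degree at most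
  \<open>s\<close> takes each value of \<open>A\<close> at most \<open>s\<close> times.\<close>

definition W :: "real set \<Rightarrow> nat \<Rightarrow> nat" where
  "W A s = (LEAST w. \<forall>p :: real poly.
     degree p \<le> s \<longrightarrow> (\<forall>i\<le>w. poly p (real i) \<in> A) \<longrightarrow> degree p = 0)"

text \<open>Integer-valued, so that the subtraction is not truncated.\<close>

definition junta_threshold :: "real set \<Rightarrow> nat \<Rightarrow> int" where
  "junta_threshold A d =
     int d + Max ((\<lambda>s. int (d div s) * (int (W A s) - int s)) ` {1..d})"

text \<open>The slice over an arbitrary coordinate set \<open>I\<close>: the finite slice is \<open>slice {1..n} k\<close>, the
  infinite one is \<open>slice {1..} k\<close>. Points are extensional functions, i.e. \<open>undefined\<close> outside \<open>I\<close>.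
  For finite \<open>I\<close>, \<open>has_sum\<close> is the ordinary finite sum. Functions on a slice are total
  functions of which only the values on the slice are ever used.\<close>

definition slice :: "nat set \<Rightarrow> nat \<Rightarrow> (nat \<Rightarrow> real) set" where
  "slice I k = {x \<in> I \<rightarrow>\<^sub>E {0, 1}. (x has_sum real k) I}"

text \<open>Real polynomials in the variables \<open>x\<^sub>i\<close>, represented as finitely supported
  maps from exponent vectors to coefficients.\<close>

type_synonym mpoly_real = "(nat \<Rightarrow>\<^sub>0 nat) \<Rightarrow>\<^sub>0 real"

definition mpoly_eval :: "mpoly_real \<Rightarrow> (nat \<Rightarrow> real) \<Rightarrow> real" where
  "mpoly_eval P x = (\<Sum>e\<in>Poly_Mapping.keys P.
     Poly_Mapping.lookup P e * (\<Prod>i\<in>Poly_Mapping.keys e. x i ^ Poly_Mapping.lookup e i))"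

definition mpoly_vars :: "mpoly_real \<Rightarrow> nat set" where
  "mpoly_vars P = (\<Union>e\<in>Poly_Mapping.keys P. Poly_Mapping.keys e)"

definition mpoly_degree_le :: "nat \<Rightarrow> mpoly_real \<Rightarrow> bool" where
  "mpoly_degree_le d P \<longleftrightarrow> (\<forall>e\<in>Poly_Mapping.keys P.
     (\<Sum>i\<in>Poly_Mapping.keys e. Poly_Mapping.lookup e i) \<le> d)"

definition finite_slice_degree :: "nat \<Rightarrow> nat \<Rightarrow> nat \<Rightarrow> ((nat \<Rightarrow> real) \<Rightarrow> real) \<Rightarrow> bool" where
  "finite_slice_degree n k d f \<longleftrightarrow>
     (\<exists>P. mpoly_vars P \<subseteq> {1..n} \<and> mpoly_degree_le d P \<and>
          (\<forall>x\<in>slice {1..n} k. f x = mpoly_eval P x))"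

text \<open>At each point of the slice only finitely many terms are nonzero, so \<open>has_sum\<close> amounts to
  a finite sum.\<close>

definition infinite_slice_degree :: "nat \<Rightarrow> nat \<Rightarrow> ((nat \<Rightarrow> real) \<Rightarrow> real) \<Rightarrow> bool" where
  "infinite_slice_degree k d f \<longleftrightarrow>
     (\<exists>c :: nat set \<Rightarrow> real. \<forall>x\<in>slice {1..} k.
        ((\<lambda>S. c S * (\<Prod>i\<in>S. x i)) has_sum f x) {S. S \<subseteq> {1..} \<and> finite S \<and> card S \<le> d})"

definition valued_on :: "real set \<Rightarrow> (nat \<Rightarrow> real) set \<Rightarrow> ((nat \<Rightarrow> real) \<Rightarrow> real) \<Rightarrow> bool" where
  "valued_on A X f \<longleftrightarrow> (\<forall>x\<in>X. f x \<in> A)"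

definition set_junta_on :: "(nat \<Rightarrow> real) set \<Rightarrow> nat set \<Rightarrow> ((nat \<Rightarrow> real) \<Rightarrow> real) \<Rightarrow> bool" where
  "set_junta_on X J f \<longleftrightarrow> (\<exists>g :: (nat \<Rightarrow> real) \<Rightarrow> real. \<forall>x\<in>X. f x = g (restrict x J))"

definition junta_on_slice :: "nat set \<Rightarrow> nat \<Rightarrow> nat \<Rightarrow> ((nat \<Rightarrow> real) \<Rightarrow> real) \<Rightarrow> bool" where
  "junta_on_slice I k m f \<longleftrightarrow>
     (\<exists>J. J \<subseteq> I \<and> finite J \<and> card J \<le> m \<and> set_junta_on (slice I k) J f)"

text \<open>The property characterising an admissible constant \<open>m(A,d)\<close>.\<close>

definition finite_junta_bound :: "real set \<Rightarrow> nat \<Rightarrow> nat \<Rightarrow> bool" where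
  "finite_junta_bound A d m \<longleftrightarrow>
     (\<forall>k n f. int k \<ge> junta_threshold A d \<longrightarrow> n \<ge> 2 * k \<longrightarrow>
        valued_on A (slice {1..n} k) f \<longrightarrow> finite_slice_degree n k d f \<longrightarrow>
        junta_on_slice {1..n} k m f)"

end

theory Submission
  imports Defs "HOL-Library.Ramsey"
begin

text \<open>
  A point of a slice is determined by its support, so a function on the slice of weight \<open>k\<close> is a
  function of \<open>k\<close>-element sets, and having degree \<open>d\<close> means being of the form
  \<open>X \<mapsto> \<Sum>S \<subseteq> X, |S| \<le> d. c S\<close>.

  \<^bold>\<open>Above the threshold\<close> the claim is a compactness argument. Restricting \<open>f\<close> to sets
  \<open>X \<subseteq> {1..n}\<close> gives a degree \<open>d\<close> function on a finite slice, which depends only on a set \<open>J\<^sub>n\<close>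
  of at most \<open>m\<close> coordinates. The sets \<open>J\<^sub>n\<close> have a limit point \<open>J\<close>: for every \<open>N\<close>, some
  \<open>J\<^sub>n\<close> with \<open>n \<ge> N\<close> satisfies \<open>J\<^sub>n \<inter> {..N} \<subseteq> J \<subseteq> J\<^sub>n\<close> (\<open>bounded_card_limit_point\<close>). Two
  inputs supported in \<open>{..N}\<close> which agree on \<open>J\<close> then agree on \<open>J\<^sub>n\<close>, so \<open>f\<close> does not
  distinguish them.

  \<^bold>\<open>Below the threshold\<close>, fix a set \<open>R\<close> of \<open>r\<close> coordinates and infinitely many disjoint
  blocks \<open>B\<^sub>0, B\<^sub>1, \<dots>\<close> of \<open>e\<close> coordinates each. For an input \<open>X\<close> containing \<open>R\<close> let \<open>T X\<close> be the
  number of blocks contained in \<open>X\<close>, and for other inputs let \<open>T X = 0\<close>. Since \<open>T\<close> is the sum of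
  the monomials of the sets \<open>R \<union> B\<^sub>i\<close>, and the monomial of \<open>R\<close> is idempotent, \<open>P (T X)\<close> has
  degree at most \<open>r + e deg P\<close>. On the slice of weight \<open>k\<close>, \<open>T\<close> takes exactly the values
  \<open>0, \<dots>, \<lfloor>(k - r) / e\<rfloor>\<close>, and all of them are attained with blocks as far out as one likes. So
  \<open>P (T X)\<close> is not a junta unless \<open>P\<close> is constant on this range (\<open>block_construction\<close>).
  If \<open>k \<le> d\<close>, then \<open>r = k - 1\<close>, \<open>e = 1\<close> and a linear \<open>P\<close> do the job. If \<open>d < k\<close>, take an \<open>s\<close>
  attaining the maximum in the threshold, \<open>e = d div s\<close> and \<open>r = d mod s\<close>: then \<open>k\<close> lies below the
  threshold exactly when \<open>\<lfloor>(k - r) / e\<rfloor> < W A s\<close>, and the minimality of \<open>W A s\<close> provides a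
  nonconstant \<open>P\<close> of degree at most \<open>s\<close> with values in \<open>A\<close> on the whole range. Since \<open>d < k\<close>, the
  range has more than \<open>s\<close> points, so \<open>P\<close> is not constant on it.
\<close>

section \<open>Slices as families of sets\<close>

text \<open>The point of the slice over \<open>I\<close> with support \<open>X\<close>; the restriction matches the convention
  that points are \<open>undefined\<close> outside \<open>I\<close>.\<close>

definition slice_point :: "nat set \<Rightarrow> nat set \<Rightarrow> nat \<Rightarrow> real" where
  "slice_point I X = restrict (indicator X) I"

text \<open>A convergent sum of zeros and ones bounds the size of every finite set of ones, so supports are
  finite and the infinite sum counts their elements.\<close>

lemma slice_eq_image_nsets: "slice I k = slice_point I ` [I]\<^bsup>k\<^esup>"
proof (intro equalityI subsetI)
  fix x assume x: "x \<in> slice I k"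
  define X where "X = {i\<in>I. x i = 1}"
  have sum: "(x has_sum real k) I" and x01: "\<And>i. i \<in> I \<Longrightarrow> x i = 0 \<or> x i = 1"
    and ext: "x \<in> extensional I"
    using x by (auto simp: slice_def PiE_def)
  have bound: "card G \<le> k" if "G \<subseteq> X" "finite G" for G
  proof -
    have "sum x G \<le> real k"
      using that x01 by (intro finite_sum_le_has_sum[OF sum]) (force simp: X_def)+
    moreover have "sum x G = (\<Sum>i\<in>G. 1)"
      using that by (intro sum.cong) (auto simp: X_def)
    ultimately show ?thesis by simp
  qed
  have fin: "finite X"
    using finite_if_finite_subsets_card_bdd[of X k] bound by blast
  have "(x has_sum real (card X)) I"
  proof (rule has_sum_finite_neutralI[OF fin])
    show "X \<subseteq> I" by (auto simp: X_def)
    show "x i = 0" if "i \<in> I - X" for i using that x01[of i] by (auto simp: X_def)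
    have "sum x X = (\<Sum>i\<in>X. 1)" by (intro sum.cong) (auto simp: X_def)
    thus "real (card X) = sum x X" by simp
  qed
  hence "real k = real (card X)" by (rule has_sum_unique[OF sum])
  hence "card X = k" by simp
  moreover have "x = slice_point I X"
  proof
    fix i show "x i = slice_point I X i"
      using x01[of i] ext by (auto simp: slice_point_def X_def extensional_def)
  qed
  moreover have "X \<subseteq> I" by (auto simp: X_def)
  ultimately show "x \<in> slice_point I ` [I]\<^bsup>k\<^esup>"
    using fin by (intro image_eqI[of x _ X]) (simp_all add: nsets_def)
next
  fix x assume "x \<in> slice_point I ` [I]\<^bsup>k\<^esup>"
  then obtain X where X: "X \<subseteq> I" "finite X" "card X = k" "x = slice_point I X"
    by (auto simp: nsets_def)
  have "(x has_sum real k) I"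
    by (rule has_sum_finite_neutralI[of X]) (use X in \<open>auto simp: slice_point_def subset_iff\<close>)
  moreover have "x \<in> I \<rightarrow>\<^sub>E {0, 1}"
    unfolding X(4) slice_point_def by (intro restrict_PiE_iff[THEN iffD2]) (auto simp: indicator_def)
  ultimately show "x \<in> slice I k" by (simp add: slice_def)
qed

lemma prod_slice_point:
  assumes "finite S" "S \<subseteq> I"
  shows "(\<Prod>i\<in>S. slice_point I X i) = (if S \<subseteq> X then 1 else 0)"
proof -
  have "(\<Prod>i\<in>S. slice_point I X i) = (\<Prod>i\<in>S. indicator X i)"
    using assms by (intro prod.cong) (auto simp: slice_point_def)
  also have "\<dots> = (if S \<subseteq> X then 1 else 0)"
    using assms(1) by (auto simp: prod_zero_iff subset_iff indicator_def)
  finally show ?thesis .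
qed

lemma infinite_slice_degree_iff:
  "infinite_slice_degree k d f \<longleftrightarrow>
     (\<exists>c. \<forall>X\<in>[{1..}]\<^bsup>k\<^esup>. f (slice_point {1..} X) = (\<Sum>S | S \<subseteq> X \<and> card S \<le> d. c S))"
proof -
  have *: "((\<lambda>S. c S * (\<Prod>i\<in>S. slice_point {1..} X i)) has_sum v)
             {S. S \<subseteq> {1..} \<and> finite S \<and> card S \<le> d} \<longleftrightarrow>
           v = (\<Sum>S | S \<subseteq> X \<and> card S \<le> d. c S)"
    (is "(?t has_sum v) ?A \<longleftrightarrow> v = sum c ?B")
    if "X \<in> [{1..}]\<^bsup>k\<^esup>" for X c v
  proof -
    have X: "X \<subseteq> {1..}" "finite X" using that by (auto simp: nsets_def)
    have "(?t has_sum v) ?A \<longleftrightarrow> (c has_sum v) ?B"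
      using X by (intro has_sum_cong_neutral) (auto simp: prod_slice_point intro: finite_subset)
    also have "\<dots> \<longleftrightarrow> v = sum c ?B"
      using X by (intro has_sum_finite_iff) auto
    finally show ?thesis .
  qed
  show ?thesis
    unfolding infinite_slice_degree_def slice_eq_image_nsets by (simp only: ball_simps * cong: ball_cong)
qed

lemma junta_on_slice_iff:
  "junta_on_slice I k m f \<longleftrightarrow>
     (\<exists>J. J \<subseteq> I \<and> finite J \<and> card J \<le> m \<and>
        (\<forall>X\<in>[I]\<^bsup>k\<^esup>. \<forall>Y\<in>[I]\<^bsup>k\<^esup>. X \<inter> J = Y \<inter> J \<longrightarrow> f (slice_point I X) = f (slice_point I Y)))"
proof -
  have "set_junta_on (slice I k) J f \<longleftrightarrow>
      (\<forall>X\<in>[I]\<^bsup>k\<^esup>. \<forall>Y\<in>[I]\<^bsup>k\<^esup>. X \<inter> J = Y \<inter> J \<longrightarrow> f (slice_point I X) = f (slice_point I Y))"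
    (is "?L \<longleftrightarrow> ?R") if J: "J \<subseteq> I" for J
  proof -
    have res: "restrict (slice_point I X) J = restrict (indicator X) J" for X
      using J by (auto simp: slice_point_def fun_eq_iff)
    have eq: "restrict (indicator X :: nat \<Rightarrow> real) J = restrict (indicator Y) J \<longleftrightarrow>
        X \<inter> J = Y \<inter> J" for X Y
      by (auto simp: fun_eq_iff restrict_def indicator_def set_eq_iff split: if_splits)
    show ?thesis
    proof
      assume ?L
      then obtain g :: "(nat \<Rightarrow> real) \<Rightarrow> real" where g: "\<And>X. X \<in> [I]\<^bsup>k\<^esup> \<Longrightarrow>
          f (slice_point I X) = g (restrict (indicator X) J)"
        unfolding set_junta_on_def slice_eq_image_nsets ball_simps res by blast
      show ?R by (intro ballI impI) (metis g eq)
    next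
      assume R: ?R
      define rep where "rep Z = (SOME Y. Y \<in> [I]\<^bsup>k\<^esup> \<and> Y \<inter> J = Z)" for Z
      define g where "g y = f (slice_point I (rep {i\<in>J. y i = 1}))" for y :: "nat \<Rightarrow> real"
      have "f (slice_point I X) = g (restrict (indicator X) J)" if X: "X \<in> [I]\<^bsup>k\<^esup>" for X
      proof -
        have "{i\<in>J. restrict (indicator X) J i = (1 :: real)} = X \<inter> J"
          by (auto simp: indicator_def)
        moreover have "rep (X \<inter> J) \<in> [I]\<^bsup>k\<^esup> \<and> rep (X \<inter> J) \<inter> J = X \<inter> J"
          unfolding rep_def by (rule someI[of _ X]) (simp add: X)
        ultimately show ?thesis
          unfolding g_def using R[rule_format, OF X, of "rep (X \<inter> J)"] by metis
      qed
      thus ?L unfolding set_junta_on_def slice_eq_image_nsets ball_simps res by blast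
    qed
  qed
  thus ?thesis unfolding junta_on_slice_def by (simp cong: conj_cong)
qed

section \<open>Above the threshold: compactness\<close>

text \<open>A multilinear polynomial, given by its coefficient function, is realised as a finitely
  supported map by sending the set \<open>S\<close> to the exponent vector which is \<open>1\<close> on \<open>S\<close>.\<close>

lemma finite_slice_degreeI:
  assumes f: "\<And>X. X \<in> [{1..n}]\<^bsup>k\<^esup> \<Longrightarrow>
    f (slice_point {1..n} X) = (\<Sum>S | S \<subseteq> X \<and> card S \<le> d. c S)"
  shows "finite_slice_degree n k d f"
proof -
  define mon :: "nat set \<Rightarrow> (nat \<Rightarrow>\<^sub>0 nat)"
    where "mon S = (\<Sum>i\<in>S. Poly_Mapping.single i 1)" for S
  define F where "F = {S. S \<subseteq> {1..n} \<and> card S \<le> d}"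
  define P :: mpoly_real where "P = (\<Sum>S\<in>F. Poly_Mapping.single (mon S) (c S))"
  have finF: "finite F" unfolding F_def by (rule finite_subset[of _ "Pow {1..n}"]) auto
  have fin: "finite S" if "S \<in> F" for S using that by (auto simp: F_def intro: finite_subset)
  have lookup_mon: "Poly_Mapping.lookup (mon S) i = (if i \<in> S then 1 else 0)" if "finite S" for S i
    using that by (simp add: mon_def lookup_sum lookup_single when_def)
  have keys_mon: "Poly_Mapping.keys (mon S) = S" if "finite S" for S
    using that by (auto simp: in_keys_iff lookup_mon split: if_splits)
  have inj: "inj_on mon F"
    by (rule inj_on_inverseI[of _ Poly_Mapping.keys]) (simp add: keys_mon fin)
  have lookup_P: "Poly_Mapping.lookup P (mon S) = c S" if "S \<in> F" for S
  proof -
    have "Poly_Mapping.lookup P (mon S) = (\<Sum>S'\<in>F. if S' = S then c S' else 0)"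
      unfolding P_def lookup_sum lookup_single when_def
      using inj that by (intro sum.cong) (auto dest: inj_onD)
    thus ?thesis using finF that by simp
  qed
  have keys_P: "Poly_Mapping.keys P \<subseteq> mon ` F"
    unfolding P_def by (rule order.trans[OF keys_sum]) auto
  have vars: "mpoly_vars P \<subseteq> {1..n}"
    unfolding mpoly_vars_def
  proof (rule UN_least)
    fix e assume "e \<in> Poly_Mapping.keys P"
    then obtain S where "S \<in> F" "e = mon S" using keys_P by auto
    thus "Poly_Mapping.keys e \<subseteq> {1..n}" using fin[of S] by (simp add: keys_mon F_def)
  qed
  have deg: "mpoly_degree_le d P"
    unfolding mpoly_degree_le_def
  proof
    fix e assume "e \<in> Poly_Mapping.keys P"
    then obtain S where S: "S \<in> F" "e = mon S" using keys_P by auto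
    thus "(\<Sum>i\<in>Poly_Mapping.keys e. Poly_Mapping.lookup e i) \<le> d"
      using fin[of S] by (simp add: keys_mon lookup_mon F_def)
  qed
  have eval: "mpoly_eval P x = (\<Sum>S\<in>F. c S * (\<Prod>i\<in>S. x i))" for x
  proof -
    have "mpoly_eval P x = (\<Sum>e\<in>mon ` F. Poly_Mapping.lookup P e *
        (\<Prod>i\<in>Poly_Mapping.keys e. x i ^ Poly_Mapping.lookup e i))"
      unfolding mpoly_eval_def using keys_P finF
      by (intro sum.mono_neutral_left) (auto simp: in_keys_iff)
    also have "\<dots> = (\<Sum>S\<in>F. c S * (\<Prod>i\<in>S. x i))"
      unfolding sum.reindex[OF inj]
      by (intro sum.cong) (auto simp: lookup_P keys_mon fin lookup_mon)
    finally show ?thesis .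
  qed
  have "f (slice_point {1..n} X) = mpoly_eval P (slice_point {1..n} X)" if X: "X \<in> [{1..n}]\<^bsup>k\<^esup>" for X
  proof -
    have "mpoly_eval P (slice_point {1..n} X) = (\<Sum>S\<in>F. if S \<subseteq> X then c S else 0)"
      unfolding eval
    proof (rule sum.cong[OF refl])
      fix S assume S: "S \<in> F"
      hence "S \<subseteq> {1..n}" by (simp add: F_def)
      with fin[OF S] show "c S * (\<Prod>i\<in>S. slice_point {1..n} X i) = (if S \<subseteq> X then c S else 0)"
        by (simp add: prod_slice_point del: One_nat_def)
    qed
    also have "\<dots> = (\<Sum>S | S \<subseteq> X \<and> card S \<le> d. c S)"
      using X finF by (intro sum.mono_neutral_cong_right) (auto simp: F_def nsets_def)
    finally show ?thesis using f[OF X] by simp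
  qed
  thus ?thesis
    using vars deg unfolding finite_slice_degree_def slice_eq_image_nsets by blast
qed

text \<open>Among the finite sets contained in infinitely many of the \<open>Jn n\<close>, one of maximal size is a
  limit point: any further element lies in only finitely many of those \<open>Jn n\<close> that contain it.\<close>

lemma bounded_card_limit_point:
  fixes Jn :: "nat \<Rightarrow> nat set"
  assumes fin: "\<And>n. finite (Jn n)" and card: "\<And>n. card (Jn n) \<le> m"
  obtains J where "\<And>N. \<exists>n\<ge>N. J \<subseteq> Jn n \<and> Jn n \<inter> {..N} \<subseteq> J"
proof -
  define Q where "Q J \<longleftrightarrow> infinite {n. J \<subseteq> Jn n}" for J
  have Q_card: "finite J \<and> card J \<le> m" if Q: "Q J" for J
  proof -
    obtain n where "J \<subseteq> Jn n" using Q unfolding Q_def by (metis Collect_empty_eq finite.emptyI)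
    thus ?thesis using fin card card_mono finite_subset by (meson le_trans)
  qed
  have "Q {}" by (simp add: Q_def)
  then obtain J where J: "Q J" "\<And>J'. Q J' \<Longrightarrow> card J' \<le> card J"
    using ex_has_greatest_nat[of Q "{}" card "Suc m"] Q_card by (metis le_imp_less_Suc)
  have "finite {n. insert i J \<subseteq> Jn n}" if "i \<notin> J" for i
    using J(2)[of "insert i J"] Q_card[OF J(1)] that by (auto simp: Q_def)
  hence finite_bad: "finite (\<Union>i\<in>{..N} - J. {n. insert i J \<subseteq> Jn n})" for N
    by auto
  have "\<exists>n\<ge>N. J \<subseteq> Jn n \<and> Jn n \<inter> {..N} \<subseteq> J" for N
  proof -
    have "infinite ({n. J \<subseteq> Jn n} - ((\<Union>i\<in>{..N} - J. {n. insert i J \<subseteq> Jn n}) \<union> {..<N}))"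
      using J(1) finite_bad[of N] by (intro Diff_infinite_finite) (auto simp: Q_def)
    then obtain n where
      "n \<in> {n. J \<subseteq> Jn n} - ((\<Union>i\<in>{..N} - J. {n. insert i J \<subseteq> Jn n}) \<union> {..<N})"
      by (metis ex_in_conv finite.emptyI)
    thus ?thesis by (intro exI[of _ n]) auto
  qed
  thus thesis using that by blast
qed

lemma junta_on_infinite_slice:
  assumes bound: "finite_junta_bound A d m" and k: "int k \<ge> junta_threshold A d"
    and val: "valued_on A (slice {1..} k) f" and deg: "infinite_slice_degree k d f"
  shows "junta_on_slice {1..} k m f"
proof -
  obtain c where c: "\<And>X. X \<in> [{1..}]\<^bsup>k\<^esup> \<Longrightarrow>
      f (slice_point {1..} X) = (\<Sum>S | S \<subseteq> X \<and> card S \<le> d. c S)"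
    using deg unfolding infinite_slice_degree_iff by blast
  define fn where "fn n y = f (slice_point {1..} {i\<in>{1..n}. y i = 1})"
    for n :: nat and y :: "nat \<Rightarrow> real"
  have fn: "fn n (slice_point {1..n} X) = f (slice_point {1..} X)" if "X \<in> [{1..n}]\<^bsup>k\<^esup>" for n X
  proof -
    have "{i\<in>{1..n}. slice_point {1..n} X i = 1} = X"
      using that by (auto simp: nsets_def slice_point_def indicator_def)
    thus ?thesis unfolding fn_def by simp
  qed
  have sub: "X \<in> [{1..}]\<^bsup>k\<^esup>" if "X \<in> [{1..n}]\<^bsup>k\<^esup>" for n X
    using that by (auto simp: nsets_def)
  have "junta_on_slice {1..n} k m (fn n)" if "n \<ge> 2 * k" for n
  proof -
    have "finite_slice_degree n k d (fn n)"
      by (rule finite_slice_degreeI[where c = c]) (simp only: fn c sub)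
    moreover have "valued_on A (slice {1..n} k) (fn n)"
      using val by (simp add: valued_on_def slice_eq_image_nsets fn sub del: One_nat_def)
    ultimately show ?thesis using bound k that unfolding finite_junta_bound_def by blast
  qed
  hence "\<exists>J. J \<subseteq> {1..n + 2 * k} \<and> finite J \<and> card J \<le> m \<and>
      (\<forall>X\<in>[{1..n + 2 * k}]\<^bsup>k\<^esup>. \<forall>Y\<in>[{1..n + 2 * k}]\<^bsup>k\<^esup>. X \<inter> J = Y \<inter> J \<longrightarrow>
         f (slice_point {1..} X) = f (slice_point {1..} Y))" for n
    by (simp add: junta_on_slice_iff fn cong: ball_cong del: One_nat_def)
  then obtain Jn where Jn: "\<And>n. Jn n \<subseteq> {1..n + 2 * k}" "\<And>n. finite (Jn n)" "\<And>n. card (Jn n) \<le> m"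
    "\<And>n X Y. X \<in> [{1..n + 2 * k}]\<^bsup>k\<^esup> \<Longrightarrow> Y \<in> [{1..n + 2 * k}]\<^bsup>k\<^esup> \<Longrightarrow> X \<inter> Jn n = Y \<inter> Jn n \<Longrightarrow>
       f (slice_point {1..} X) = f (slice_point {1..} Y)"
    by metis
  obtain J where J: "\<And>N. \<exists>n\<ge>N. J \<subseteq> Jn n \<and> Jn n \<inter> {..N} \<subseteq> J"
    using bounded_card_limit_point[of Jn m] Jn(2,3) by blast
  obtain n0 where n0: "J \<subseteq> Jn n0" using J by blast
  have "J \<subseteq> {1..}" "finite J" "card J \<le> m"
  proof -
    show "J \<subseteq> {1..}" using n0 Jn(1)[of n0] by auto
    show "finite J" using n0 Jn(2) finite_subset by blast
    show "card J \<le> m" using card_mono[OF Jn(2) n0] Jn(3)[of n0] by linarith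
  qed
  moreover have "f (slice_point {1..} X) = f (slice_point {1..} Y)"
    if X: "X \<in> [{1..}]\<^bsup>k\<^esup>" and Y: "Y \<in> [{1..}]\<^bsup>k\<^esup>" and agree: "X \<inter> J = Y \<inter> J" for X Y
  proof -
    have "finite (X \<union> Y)" using X Y by (auto simp: nsets_def)
    then obtain N where N: "X \<union> Y \<subseteq> {..N}" using finite_nat_set_iff_bounded_le by auto
    obtain n where n: "n \<ge> N" "J \<subseteq> Jn n" "Jn n \<inter> {..N} \<subseteq> J" using J by blast
    have "X \<inter> Jn n = Y \<inter> Jn n" using N n(2,3) agree by blast
    moreover have "Z \<in> [{1..n + 2 * k}]\<^bsup>k\<^esup>" if "Z \<in> [{1..}]\<^bsup>k\<^esup>" "Z \<subseteq> {..N}" for Z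
    proof -
      have "{1..} \<inter> {..N} \<subseteq> {1..n + 2 * k}" using n(1) by auto
      thus ?thesis using that unfolding nsets_def by blast
    qed
    ultimately show ?thesis using X Y N by (intro Jn(4)[of X n Y]) auto
  qed
  ultimately show ?thesis
    unfolding junta_on_slice_iff by (intro exI[of _ J] conjI ballI impI)
qed

section \<open>Degree of functions of finite sets\<close>

text \<open>The degree of a function on all finitely supported points of the cube. Since it is independent
  of \<open>k\<close>, it can be computed for sums and products before restricting to a slice.\<close>

definition set_degree_le :: "nat \<Rightarrow> (nat set \<Rightarrow> real) \<Rightarrow> bool" where
  "set_degree_le d F \<longleftrightarrow>
     (\<exists>c. \<forall>X. finite X \<longrightarrow> F X = (\<Sum>S | S \<subseteq> X \<and> card S \<le> d. c S))"

lemma set_degree_leE: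
  assumes "set_degree_le d F"
  obtains c where "\<And>X. finite X \<Longrightarrow> F X = (\<Sum>S | S \<subseteq> X \<and> card S \<le> d. c S)"
  using assms unfolding set_degree_le_def by blast

lemma set_degree_le_const: "set_degree_le 0 (\<lambda>X. a)"
  unfolding set_degree_le_def
proof (intro exI[of _ "\<lambda>S. a"] allI impI)
  fix X :: "nat set" assume "finite X"
  hence empty: "{S. S \<subseteq> X \<and> card S \<le> 0} = {{}}" by (auto dest: finite_subset)
  show "a = (\<Sum>S | S \<subseteq> X \<and> card S \<le> 0. a)" unfolding empty by simp
qed

lemma set_degree_le_add:
  assumes "set_degree_le d F" "set_degree_le d G"
  shows "set_degree_le d (\<lambda>X. F X + G X)"
proof -
  obtain a where "\<And>X. finite X \<Longrightarrow> F X = (\<Sum>S | S \<subseteq> X \<and> card S \<le> d. a S)"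
    using set_degree_leE[OF assms(1)] by blast
  moreover obtain b where "\<And>X. finite X \<Longrightarrow> G X = (\<Sum>S | S \<subseteq> X \<and> card S \<le> d. b S)"
    using set_degree_leE[OF assms(2)] by blast
  ultimately show ?thesis unfolding set_degree_le_def
    by (intro exI[of _ "\<lambda>S. a S + b S"]) (simp add: sum.distrib)
qed

lemma set_degree_le_mono:
  assumes "set_degree_le d F" "d \<le> d'"
  shows "set_degree_le d' F"
proof -
  obtain c where c: "\<And>X. finite X \<Longrightarrow> F X = (\<Sum>S | S \<subseteq> X \<and> card S \<le> d. c S)"
    using set_degree_leE[OF assms(1)] by blast
  have "F X = (\<Sum>S | S \<subseteq> X \<and> card S \<le> d'. if card S \<le> d then c S else 0)" if "finite X" for X
    unfolding c[OF that] using that assms(2) by (intro sum.mono_neutral_cong_left) auto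
  thus ?thesis unfolding set_degree_le_def by blast
qed

text \<open>The monomials of \<open>S\<close> and \<open>S'\<close> multiply to the monomial of \<open>S \<union> S'\<close>.\<close>

lemma set_degree_le_mult:
  assumes "set_degree_le d F" "set_degree_le d' G"
  shows "set_degree_le (d + d') (\<lambda>X. F X * G X)"
proof -
  obtain a where a: "\<And>X. finite X \<Longrightarrow> F X = (\<Sum>S | S \<subseteq> X \<and> card S \<le> d. a S)"
    using set_degree_leE[OF assms(1)] by blast
  obtain b where b: "\<And>X. finite X \<Longrightarrow> G X = (\<Sum>S | S \<subseteq> X \<and> card S \<le> d'. b S)"
    using set_degree_leE[OF assms(2)] by blast
  define pairs where "pairs U = {(S, S'). S \<union> S' = U \<and> card S \<le> d \<and> card S' \<le> d'}"
    for U :: "nat set"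
  define c where "c U = (\<Sum>(S, S')\<in>pairs U. a S * b S')" for U
  have "F X * G X = (\<Sum>U | U \<subseteq> X \<and> card U \<le> d + d'. c U)" if X: "finite X" for X
  proof -
    let ?A = "{S. S \<subseteq> X \<and> card S \<le> d}" and ?B = "{S. S \<subseteq> X \<and> card S \<le> d'}"
    let ?U = "{U. U \<subseteq> X \<and> card U \<le> d + d'}"
    have "F X * G X = (\<Sum>p\<in>?A \<times> ?B. a (fst p) * b (snd p))"
      unfolding a[OF X] b[OF X] sum_product by (simp add: sum.cartesian_product case_prod_beta)
    also have "\<dots> = (\<Sum>U\<in>?U. \<Sum>p | p \<in> ?A \<times> ?B \<and> fst p \<union> snd p = U. a (fst p) * b (snd p))"
    proof (rule sum.group[symmetric])
      have "card (S \<union> S') \<le> d + d'" if "card S \<le> d" "card S' \<le> d'" for S S' :: "nat set"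
        using card_Un_le[of S S'] that by linarith
      thus "(\<lambda>p. fst p \<union> snd p) ` (?A \<times> ?B) \<subseteq> ?U" by auto
    qed (use X in auto)
    also have "\<dots> = (\<Sum>U\<in>?U. c U)"
      unfolding c_def
      by (intro sum.cong) (auto simp: pairs_def case_prod_beta intro!: sum.cong)
    finally show ?thesis .
  qed
  thus ?thesis unfolding set_degree_le_def by blast
qed

lemma set_degree_le_poly:
  assumes F: "set_degree_le e F"
  shows "set_degree_le (e * degree P) (\<lambda>X. poly P (F X))"
proof (induction P)
  case 0
  show ?case using set_degree_le_const[of 0] by simp
next
  case (pCons a q)
  show ?case
  proof (cases "q = 0")
    case True
    thus ?thesis using set_degree_le_const[of a] by simp
  next
    case False
    have "set_degree_le (e + e * degree q) (\<lambda>X. a + F X * poly q (F X))"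
      by (intro set_degree_le_add set_degree_le_mult F pCons.IH
          set_degree_le_mono[OF set_degree_le_const]) simp
    thus ?thesis using False by simp
  qed
qed

text \<open>A possibly infinite sum of distinct monomials, all of the same degree.\<close>

lemma set_degree_le_count:
  fixes B :: "'i \<Rightarrow> nat set"
  assumes "inj B" and card: "\<And>i. card (B i) = e"
  shows "set_degree_le e (\<lambda>X. real (card {i. B i \<subseteq> X}))"
  unfolding set_degree_le_def
proof (intro exI[of _ "\<lambda>S. if S \<in> range B then 1 else 0"] allI impI)
  fix X :: "nat set" assume X: "finite X"
  have "(\<Sum>S | S \<subseteq> X \<and> card S \<le> e. if S \<in> range B then 1 else 0) =
      (\<Sum>S\<in>B ` {i. B i \<subseteq> X}. 1 :: real)"
    using X card by (intro sum.mono_neutral_cong_right) auto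
  also have "\<dots> = real (card {i. B i \<subseteq> X})"
    using assms(1) by (simp add: card_image inj_on_subset)
  finally show "real (card {i. B i \<subseteq> X}) =
      (\<Sum>S | S \<subseteq> X \<and> card S \<le> e. if S \<in> range B then 1 else 0)" by simp
qed

lemma set_degree_le_monomial: "set_degree_le (card R) (\<lambda>X. if R \<subseteq> X then 1 else 0)"
proof -
  have "set_degree_le (card R) (\<lambda>X. real (card {i :: unit. R \<subseteq> X}))"
    by (rule set_degree_le_count[of "\<lambda>_. R"]) (auto intro: injI)
  moreover have "real (card {i :: unit. R \<subseteq> X}) = (if R \<subseteq> X then 1 else 0)" for X
    by auto
  ultimately show ?thesis by simp
qed

section \<open>Below the threshold: counting blocks\<close>

text \<open>All coordinates beyond \<open>r\<close> are arranged in an array with infinitely many rows and columns.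
  The blocks below are the first \<open>e\<close> entries of the rows, the entries in column \<open>e\<close> are used to
  pad an input to size \<open>k\<close> without completing a block.\<close>

definition cell :: "nat \<Rightarrow> nat \<Rightarrow> nat \<Rightarrow> nat" where
  "cell r i j = Suc (r + prod_encode (i, j))"

lemma cell_eq_iff [simp]: "cell r i j = cell r i' j' \<longleftrightarrow> i = i' \<and> j = j'"
  by (simp add: cell_def)

lemma cell_gt: "r < cell r i j" "i < cell r i j"
  using le_prod_encode_1[of i j] by (auto simp: cell_def)

text \<open>An input of size \<open>k\<close> containing \<open>R\<close> has room for at most \<open>(k - r) div e\<close> disjoint blocks,
  which is why the values of \<open>P\<close> matter only up to there. Any finite set \<open>J\<close> of coordinates is
  missed by all rows far enough out, so inputs with \<open>0\<close> and with \<open>t0\<close> blocks can be chosen to agree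
  on \<open>J\<close>.\<close>

lemma block_construction:
  fixes P :: "real poly"
  assumes e: "e \<ge> 1" and r: "r \<le> k" and deg: "r + e * degree P \<le> d"
    and val: "\<And>t. t \<le> (k - r) div e \<Longrightarrow> poly P (real t) \<in> A"
    and t0: "t0 \<le> (k - r) div e" "poly P (real t0) \<noteq> poly P 0"
  shows "\<exists>f. valued_on A (slice {1..} k) f \<and> infinite_slice_degree k d f \<and>
             (\<forall>m. \<not> junta_on_slice {1..} k m f)"
proof -
  define R where "R = {1..r}"
  define B where "B i = cell r i ` {..<e}" for i
  define T where "T X = card {i. B i \<subseteq> X}" for X
  define F where "F X = (if R \<subseteq> X then poly P (real (T X)) else poly P 0)" for X
  define f where "f x = F {i. 1 \<le> i \<and> x i = 1}" for x :: "nat \<Rightarrow> real"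
  have f: "f (slice_point {1..} X) = F X" if "X \<in> [{1..}]\<^bsup>k\<^esup>" for X
  proof -
    have "{i. 1 \<le> i \<and> slice_point {1..} X i = 1} = X"
      using that by (auto simp: nsets_def slice_point_def indicator_def)
    thus ?thesis by (simp add: f_def)
  qed
  have card_B: "card (B i) = e" and fin_B: "finite (B i)" for i
    by (simp_all add: B_def card_image inj_on_def)
  have disj: "B i \<inter> B j = {}" if "i \<noteq> j" for i j
    using that by (auto simp: B_def)
  have B_ne: "B i \<noteq> {}" for i using card_B[of i] e by auto
  have inj_B: "inj B" using disj B_ne by (metis Int_absorb injI)
  have R_B: "R \<inter> B i = {}" for i
  proof -
    have "cell r i j \<notin> R" for j using cell_gt(1)[of r i j] by (simp add: R_def)
    thus ?thesis by (auto simp: B_def)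
  qed

  \<comment> \<open>The monomial of \<open>R\<close> enters once, not once per factor \<open>T\<close>: this keeps the degree at \<open>r + e deg P\<close>.\<close>
  have "set_degree_le (r + e * degree P) F"
  proof -
    have degT: "set_degree_le e (\<lambda>X. real (T X))"
      unfolding T_def by (rule set_degree_le_count[OF inj_B card_B])
    have degR: "set_degree_le r (\<lambda>X. if R \<subseteq> X then 1 else 0)"
      using set_degree_le_monomial[of R] by (simp add: R_def)
    have degPT: "set_degree_le (e * degree P) (\<lambda>X. poly P (real (T X)) + - poly P 0)"
      by (intro set_degree_le_add set_degree_le_poly degT set_degree_le_mono[OF set_degree_le_const]) simp
    have "set_degree_le (r + e * degree P)
        (\<lambda>X. poly P 0 + (if R \<subseteq> X then 1 else 0) * (poly P (real (T X)) + - poly P 0))"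
      by (intro set_degree_le_add set_degree_le_mult degR degPT
          set_degree_le_mono[OF set_degree_le_const]) simp
    moreover have "(\<lambda>X. poly P 0 + (if R \<subseteq> X then 1 else 0) * (poly P (real (T X)) + - poly P 0)) = F"
      by (auto simp: F_def)
    ultimately show ?thesis by simp
  qed
  hence "set_degree_le d F" using deg set_degree_le_mono by blast
  hence degree_f: "infinite_slice_degree k d f"
    unfolding infinite_slice_degree_iff set_degree_le_def using f by (auto simp: nsets_def)

  have "F X \<in> A" if X: "X \<in> [{1..}]\<^bsup>k\<^esup>" for X
  proof (cases "R \<subseteq> X")
    case True
    have finX: "finite X" and cardX: "card X = k" using X by (auto simp: nsets_def)
    have "finite (B ` {i. B i \<subseteq> X})" by (rule finite_subset[of _ "Pow X"]) (use finX in auto)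
    hence fin: "finite {i. B i \<subseteq> X}" using inj_B by (meson finite_imageD inj_on_subset subset_UNIV)
    have "r + e * T X = card R + card (\<Union>i\<in>{i. B i \<subseteq> X}. B i)"
      using fin fin_B disj by (subst card_UN_disjoint) (auto simp: T_def card_B R_def)
    also have "\<dots> = card (R \<union> (\<Union>i\<in>{i. B i \<subseteq> X}. B i))"
      using fin fin_B R_B by (subst card_Un_disjoint) (auto simp: R_def)
    also have "\<dots> \<le> card X" using True finX by (intro card_mono) auto
    finally have "T X * e \<le> k - r" using cardX by (simp add: mult.commute)
    hence "T X \<le> (k - r) div e" using e by (simp add: less_eq_div_iff_mult_less_eq)
    thus ?thesis using True val by (simp add: F_def)
  next
    case False
    thus ?thesis using val[of 0] by (simp add: F_def)
  qed
  hence val_f: "valued_on A (slice {1..} k) f"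
    by (simp add: valued_on_def slice_eq_image_nsets f del: One_nat_def)

  have "\<not> junta_on_slice {1..} k m f" for m
  proof
    assume "junta_on_slice {1..} k m f"
    then obtain J where J: "finite J"
      "\<forall>X\<in>[{1..}]\<^bsup>k\<^esup>. \<forall>Y\<in>[{1..}]\<^bsup>k\<^esup>. X \<inter> J = Y \<inter> J \<longrightarrow>
         f (slice_point {1..} X) = f (slice_point {1..} Y)"
      unfolding junta_on_slice_iff by auto
    obtain M where M: "J \<subseteq> {..M}" using J(1) finite_nat_set_iff_bounded_le by auto
    \<comment> \<open>\<open>X u\<close> consists of \<open>R\<close>, of \<open>u\<close> blocks and of padding, the latter two beyond \<open>J\<close>.\<close>
    define C where "C u = (SIGMA i:{M..<M + u}. {..<e}) \<union> {M..<M + (k - r - u * e)} \<times> {e}" for u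
    define X where "X u = R \<union> (\<lambda>(i, j). cell r i j) ` C u" for u
    have fin_C: "finite (C u)" for u by (simp add: C_def)
    have R_C: "R \<inter> (\<lambda>(i, j). cell r i j) ` C u = {}" for u
    proof -
      have "cell r i j \<notin> R" for i j using cell_gt(1)[of r i j] by (simp add: R_def)
      thus ?thesis by auto
    qed
    have X_nsets: "X u \<in> [{1..}]\<^bsup>k\<^esup>" if "u \<le> (k - r) div e" for u
    proof -
      have le: "u * e \<le> k - r" using that e by (simp add: less_eq_div_iff_mult_less_eq)
      have "card (C u) = u * e + (k - r - u * e)"
        unfolding C_def by (subst card_Un_disjoint) auto
      hence "card (C u) = k - r" using le by simp
      moreover have "card ((\<lambda>(i, j). cell r i j) ` C u) = card (C u)"
        by (rule card_image) (auto simp: inj_on_def)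
      ultimately have "card (X u) = k"
        unfolding X_def using R_C fin_C r by (subst card_Un_disjoint) (auto simp: R_def)
      thus ?thesis using fin_C by (auto simp: nsets_def X_def R_def cell_def)
    qed
    have X_J: "X u \<inter> J = R \<inter> J" for u
    proof -
      have "cell r i j \<notin> J" if "i \<ge> M" for i j
        using M cell_gt(2)[of i r j] that by auto
      thus ?thesis by (auto simp: X_def C_def)
    qed
    have T_X: "T (X u) = u" for u
    proof -
      have mem: "cell r i j \<in> X u \<longleftrightarrow> (i, j) \<in> C u" for i j
        using cell_gt(1)[of r i j] by (force simp: X_def R_def)
      have "(i, j) \<in> C u \<longleftrightarrow> i \<in> {M..<M + u}" if "j < e" for i j
        using that by (auto simp: C_def)
      hence "B i \<subseteq> X u \<longleftrightarrow> (\<forall>j<e. i \<in> {M..<M + u})" for i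
        by (auto simp: B_def mem)
      moreover have "\<exists>j. j < e" using e by (intro exI[of _ 0]) simp
      ultimately have "{i. B i \<subseteq> X u} = {M..<M + u}" by blast
      thus ?thesis by (simp add: T_def)
    qed
    have F_X: "F (X u) = poly P (real u)" for u
      using T_X by (simp add: F_def) (simp add: X_def)
    have "F (X t0) = F (X 0)"
      using J(2)[rule_format, of "X t0" "X 0"] X_nsets[OF t0(1)] X_nsets[of 0] X_J f
      by (simp del: One_nat_def)
    thus False using t0(2) by (simp add: F_X)
  qed
  thus ?thesis using val_f degree_f by blast
qed

text \<open>A value attained at more than \<open>degree P\<close> points is attained everywhere.\<close>

lemma nonconstant_poly_on_initial_segment:
  fixes P :: "real poly"
  assumes "degree P \<noteq> 0" and "degree P \<le> N"
  obtains t where "t \<le> N" "poly P (real t) \<noteq> poly P 0"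
proof (rule ccontr)
  assume "\<not> thesis"
  with that have all: "\<And>t. t \<le> N \<Longrightarrow> poly P (real t) = poly P 0" by blast
  define Q where "Q = P - [:poly P 0:]"
  have "P \<noteq> [:poly P 0:]" using assms(1) by (metis degree_pCons_0)
  hence Q0: "Q \<noteq> 0" by (simp add: Q_def)
  have "real ` {..N} \<subseteq> {x. poly Q x = 0}" using all by (auto simp: Q_def)
  hence "card (real ` {..N}) \<le> card {x. poly Q x = 0}"
    using poly_roots_finite[OF Q0] by (rule card_mono[rotated])
  also have "\<dots> \<le> degree Q" using Q0 by (rule card_poly_roots_bound)
  also have "\<dots> \<le> degree P" unfolding Q_def using degree_diff_le_max[of P "[:poly P 0:]"] by simp
  finally show False using assms(2) by (simp add: card_image inj_on_def)
qed

lemma poly_below_W: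
  assumes "w < W A s"
  obtains P :: "real poly" where "degree P \<le> s" "degree P \<noteq> 0" "\<forall>i\<le>w. poly P (real i) \<in> A"
  using not_less_Least[OF assms[unfolded W_def]] by blast

lemma non_junta_below_threshold:
  assumes A: "card A \<ge> 2" and d: "d \<ge> 1" and k: "k \<ge> 1" "int k < junta_threshold A d"
  shows "\<exists>f. valued_on A (slice {1..} k) f \<and> infinite_slice_degree k d f \<and>
             (\<forall>m. \<not> junta_on_slice {1..} k m f)"
proof (cases "k \<le> d")
  case True
  obtain a b where ab: "a \<in> A" "b \<in> A" "a \<noteq> b"
  proof -
    obtain B where "B \<subseteq> A" "card B = 2" using obtain_subset_with_card_n[OF A] by metis
    thus ?thesis using that by (auto simp: card_2_iff)
  qed
  \<comment> \<open>Prefix of size \<open>k - 1\<close>, blocks of size \<open>1\<close>: the number of blocks is \<open>0\<close> or \<open>1\<close>.\<close>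
  let ?P = "[:a, b - a:]"
  have "poly ?P (real t) \<in> A" if "t \<le> (k - (k - 1)) div 1" for t
  proof -
    have "t = 0 \<or> t = 1" using that k(1) by auto
    thus ?thesis using ab by auto
  qed
  moreover have "poly ?P (real 1) \<noteq> poly ?P 0" using ab by simp
  moreover have "k - 1 + 1 * degree ?P \<le> d" using True k(1) ab by simp
  ultimately show ?thesis
    using k(1) by (intro block_construction[of 1 "k - 1" k ?P d A 1]) auto
next
  case False
  have "junta_threshold A d - int d \<in> (\<lambda>s. int (d div s) * (int (W A s) - int s)) ` {1..d}"
    unfolding junta_threshold_def using d Max_in[of "(\<lambda>s. int (d div s) * (int (W A s) - int s)) ` {1..d}"] by simp
  then obtain s where s: "s \<in> {1..d}"
    and thr: "junta_threshold A d = int d + int (d div s) * (int (W A s) - int s)"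
    by (auto simp del: atLeastAtMost_iff)
  define e r where "e = d div s" and "r = d mod s"
  have e1: "e \<ge> 1" using s by (simp add: e_def div_greater_zero_iff Suc_le_eq)
  have d_eq: "d = e * s + r" by (simp add: e_def r_def)
  have "int k < int r + int e * int (W A s)"
    using k(2) thr unfolding e_def[symmetric] by (simp add: d_eq algebra_simps)
  hence lt: "k < r + e * W A s" by (metis of_nat_add of_nat_less_iff of_nat_mult)
  have "e * s < k - r" using False d_eq by linarith
  hence s_le: "s \<le> (k - r) div e" using e1 by (simp add: less_eq_div_iff_mult_less_eq mult.commute)
  have "k - r < W A s * e" using lt False d_eq by (simp add: mult.commute)
  hence W: "(k - r) div e < W A s" using e1 by (simp add: div_less_iff_less_mult)
  obtain P :: "real poly" where P: "degree P \<le> s" "degree P \<noteq> 0"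
    "\<forall>i\<le>(k - r) div e. poly P (real i) \<in> A"
    by (rule poly_below_W[OF W])
  obtain t where t: "t \<le> (k - r) div e" "poly P (real t) \<noteq> poly P 0"
    by (rule nonconstant_poly_on_initial_segment[OF P(2) order.trans[OF P(1) s_le]])
  have "r + e * degree P \<le> d" using P(1) d_eq by (simp add: add.commute)
  thus ?thesis
    using block_construction[OF e1 _ _ P(3)[rule_format] t] False d_eq by auto
qed

theorem theorem1p3:
  fixes A :: "real set" and d :: nat
  assumes "finite A" and "card A \<ge> 2" and "d \<ge> 1"
  shows "(\<forall>m. finite_junta_bound A d m \<longrightarrow>
            (\<forall>k f. int k \<ge> junta_threshold A d \<longrightarrow>
                   valued_on A (slice {1..} k) f \<longrightarrow> infinite_slice_degree k d f \<longrightarrow>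
                   junta_on_slice {1..} k m f)) \<and>
         (\<forall>k. 1 \<le> k \<and> int k < junta_threshold A d \<longrightarrow>
            (\<exists>f. valued_on A (slice {1..} k) f \<and> infinite_slice_degree k d f \<and>
                 (\<forall>m. \<not> junta_on_slice {1..} k m f)))"
  using junta_on_infinite_slice non_junta_below_threshold[OF assms(2,3)] by blast

end
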